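(* For any $1<t<3/2$, the operator $K_{2t}:L^{\frac{1}{3-2t}}(\mathbb D)\to L^{1,\infty}(\mathbb D)$ is bounded, where $$K_{2t}f(z):=\int_{\mathbb D}\frac{f(w)}{(1-z\overline w)^{2t}}\,dA(w),\qquad z\in\mathbb D.$$
   Context: $\mathbb D$ is the open unit disc in $\mathbb C$, $dA$ is normalized area measure on $\mathbb D$, $|E|$ is the $dA$-measure of $E$, and $L^p(\mathbb D)$ is taken with respect to $dA$. $L^{1,\infty}(\mathbb D)$ is weak $L^1$: $\|f\|_{L^{1,\infty}(\mathbb D)}:=\sup_{\lambda>0}\lambda|\{z\in\mathbb D:|f(z)|>\lambda\}|$. *)

theory Defs
  imports "HOL-Analysis.Analysis"
begin

abbreviation unit_disc :: "complex set" where
  "unit_disc \<equiv> ball 0 1"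

definition dA :: "complex measure" where
  "dA = scale_measure (ennreal (1 / pi)) (lebesgue_on unit_disc)"

lemma space_dA: "space dA = unit_disc"
  by (simp add: dA_def space_scale_measure)

lemma emeasure_dA_unit_disc: "emeasure dA unit_disc = 1"
proof -
  have "emeasure (lebesgue_on unit_disc) unit_disc = ennreal pi"
    using emeasure_ball[of 1 "0 :: complex"]
    by (simp add: emeasure_restrict_space eval_unit_ball_vol)
  then show ?thesis
    by (simp add: dA_def flip: ennreal_mult)
qed

text \<open>The spaces below consist of functions rather than of classes modulo equality almost
  everywhere; only the values of a function on the unit disc matter.\<close>

definition Lp :: "real \<Rightarrow> (complex \<Rightarrow> complex) set" where
  "Lp p = {f \<in> borel_measurable dA. integrable dA (\<lambda>z. norm (f z) powr p)}"

definition Lp_norm :: "real \<Rightarrow> (complex \<Rightarrow> complex) \<Rightarrow> real" where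
  "Lp_norm p f = (\<integral>z. norm (f z) powr p \<partial>dA) powr (1 / p)"

definition weak_L1_norm :: "(complex \<Rightarrow> complex) \<Rightarrow> ennreal" where
  "weak_L1_norm f =
     (SUP l\<in>{0<..}. ennreal l * emeasure dA {z \<in> unit_disc. norm (f z) > l})"

definition weak_L1 :: "(complex \<Rightarrow> complex) set" where
  "weak_L1 = {f \<in> borel_measurable dA. weak_L1_norm f < \<infinity>}"

text \<open>Linearity together with the norm estimate makes \<open>T\<close> well defined on classes modulo
  equality almost everywhere.\<close>

definition bounded_Lp_to_weak_L1 ::
    "real \<Rightarrow> ((complex \<Rightarrow> complex) \<Rightarrow> (complex \<Rightarrow> complex)) \<Rightarrow> bool" where
  "bounded_Lp_to_weak_L1 p T \<longleftrightarrow>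
     (\<forall>f\<in>Lp p. T f \<in> weak_L1) \<and>
     (\<forall>f\<in>Lp p. \<forall>g\<in>Lp p. \<forall>a b.
        AE z in dA. T (\<lambda>w. a * f w + b * g w) z = a * T f z + b * T g z) \<and>
     (\<exists>C\<ge>0. \<forall>f\<in>Lp p. weak_L1_norm (T f) \<le> ennreal (C * Lp_norm p f))"

text \<open>For \<open>z\<close>, \<open>w\<close> in the unit disc, \<open>1 - z * cnj w\<close> lies in the right half-plane, where
  \<open>powr\<close> is the holomorphic branch taking the value 1 at 1.\<close>

definition K_integrand :: "real \<Rightarrow> (complex \<Rightarrow> complex) \<Rightarrow> complex \<Rightarrow> complex \<Rightarrow> complex" where
  "K_integrand \<alpha> f z w = f w / (1 - z * cnj w) powr (of_real \<alpha>)"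

definition K_op :: "real \<Rightarrow> (complex \<Rightarrow> complex) \<Rightarrow> complex \<Rightarrow> complex" where
  "K_op \<alpha> f z = (\<integral>w. K_integrand \<alpha> f z w \<partial>dA)"

end

theory Submission
  imports Defs
begin

text \<open>
  Write \<open>a = 2 * t\<close>, \<open>s = a - 2\<close> and \<open>p = 1 / (3 - a)\<close>, so that \<open>1 / p = 1 - s\<close> with
  \<open>0 < s < 1\<close>. The estimate survives taking absolute values inside the integral, and it is proved
  for the positive kernel \<open>D(z, w) powr - a\<close>, where \<open>D(z, w) = \<bar>1 - z * cnj w\<bar>\<close>.
  This kernel fails Schur's test only because of points near the unit circle:
  \<open>D\<close> is at least \<open>\<bar>z - w\<bar>\<close> and at least \<open>1 - \<bar>z\<bar>\<close>, so if \<open>D \<ge> d\<close> is imposed, then the kernel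
  has integral at most \<open>C * d powr - s\<close> in either variable (\<open>nn_integral_kernel_le\<close>).

  Let \<open>E\<close> be the set where \<open>\<bar>K f\<bar> > l\<close>, and let \<open>e\<close> be its measure. A weak-type
  estimate allows half of \<open>E\<close> to be thrown away: the annulus \<open>\<bar>z\<bar> > 1 - e / 4\<close> has
  measure at most \<open>e / 2\<close>, so the part \<open>E'\<close> of \<open>E\<close> outside this annulus still has measure at
  least \<open>e / 2\<close>, and on it \<open>D \<ge> d = e / 4\<close>. The pointwise bound
  \<open>\<bar>f\<bar> \<le> T powr (1 - p) * \<bar>f\<bar> powr p + T\<close> together with Tonelli's theorem then gives
  \<open>l * e / 2 \<le> \<integral>\<^sub>E\<^sub>' \<bar>K f\<bar> \<le> C * d powr - s * (T powr (1 - p) * N powr p + T * e)\<close>,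
  where \<open>N\<close> bounds the \<open>L\<^sup>p\<close> norm of \<open>f\<close> (\<open>nn_integral_K_op_le\<close>). The two summands balance for
  \<open>T = N * e powr (- 1 / p)\<close>, and both are then \<open>N * e powr s\<close>. As \<open>d\<close> is proportional to \<open>e\<close>,
  all powers of \<open>e\<close> cancel and \<open>l * e\<close> is bounded by a multiple of \<open>N\<close>
  (\<open>distribution_K_op_le\<close>). This cancellation is where the exponent \<open>p\<close> is used.
\<close>

section \<open>Normalized area measure on the disc\<close>

lemma sets_dA: "sets dA = sets (lebesgue_on unit_disc)"
  by (simp add: dA_def)

lemma finite_measure_dA: "finite_measure dA"
  by (rule finite_measureI) (simp add: space_dA emeasure_dA_unit_disc)

interpretation dA: finite_measure dA
  by (rule finite_measure_dA)

interpretation dA2: pair_sigma_finite dA dA ..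

lemma measurable_ident_dA [measurable]: "(\<lambda>z. z) \<in> borel_measurable dA"
proof -
  have "(\<lambda>z::complex. z) \<in> borel_measurable (lebesgue_on unit_disc)"
    by (intro measurable_restrict_space1 measurable_completion) simp
  then show ?thesis
    by (simp add: measurable_cong_sets[OF sets_dA refl])
qed

lemma borel_Int_disc_in_sets_dA: "B \<in> sets borel \<Longrightarrow> B \<inter> unit_disc \<in> sets dA"
  using measurable_sets[OF measurable_ident_dA, of B] by (simp add: space_dA)

lemma emeasure_dA_subset_disc:
  assumes "B \<in> sets borel" "B \<subseteq> unit_disc"
  shows "emeasure dA B = ennreal (1 / pi) * emeasure lborel B"
  using assms by (simp add: dA_def emeasure_restrict_space)

lemma emeasure_dA_ball_le:
  assumes "0 \<le> r"
  shows "emeasure dA (ball a r \<inter> unit_disc) \<le> ennreal (r\<^sup>2)"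
proof -
  have "emeasure dA (ball a r \<inter> unit_disc)
      = ennreal (1 / pi) * emeasure lborel (ball a r \<inter> unit_disc)"
    by (rule emeasure_dA_subset_disc) auto
  also have "\<dots> \<le> ennreal (1 / pi) * emeasure lborel (ball a r)"
    by (intro mult_left_mono emeasure_mono) auto
  also have "\<dots> = ennreal (1 / pi) * ennreal (pi * r\<^sup>2)"
    using assms emeasure_ball[of r a] by (simp add: eval_unit_ball_vol)
  also have "\<dots> = ennreal (r\<^sup>2)"
    using assms by (simp flip: ennreal_mult)
  finally show ?thesis .
qed

lemma measure_dA_boundary_annulus_le:
  assumes "0 < d" "d \<le> 1"
  shows "measure dA (unit_disc - cball 0 (1 - d)) \<le> 2 * d"
proof -
  have sub: "cball 0 (1 - d) \<subseteq> unit_disc"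
    using assms by (auto simp: subset_iff)
  have "emeasure dA (cball 0 (1 - d)) = ennreal (1 / pi) * emeasure lborel (cball (0::complex) (1 - d))"
    by (rule emeasure_dA_subset_disc) (use sub in auto)
  also have "\<dots> = ennreal ((1 - d)\<^sup>2)"
    using assms emeasure_cball[of "1 - d" "0::complex"]
    by (simp add: eval_unit_ball_vol flip: ennreal_mult)
  finally have c: "measure dA (cball 0 (1 - d)) = (1 - d)\<^sup>2"
    by (simp add: measure_def)
  have "measure dA (unit_disc - cball 0 (1 - d))
      = measure dA unit_disc - measure dA (cball 0 (1 - d))"
  proof (rule dA.finite_measure_Diff)
    show "cball 0 (1 - d) \<in> sets dA"
      using borel_Int_disc_in_sets_dA[of "cball 0 (1 - d)"] sub by (simp add: Int_absorb2)
    show "unit_disc \<in> sets dA"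
      using borel_Int_disc_in_sets_dA[of UNIV] by simp
  qed (rule sub)
  also have "\<dots> = 1 - (1 - d)\<^sup>2"
    by (simp add: c) (simp add: measure_def emeasure_dA_unit_disc)
  also have "\<dots> \<le> 2 * d"
    by (simp add: power2_eq_square algebra_simps)
  finally show ?thesis .
qed

section \<open>The kernel\<close>

text \<open>The difference of the squares of the two sides is
  \<open>(1 - \<bar>z\<bar>\<^sup>2) * (1 - \<bar>w\<bar>\<^sup>2)\<close>.\<close>

lemma norm_one_minus_mult_cnj_ge_dist:
  assumes "z \<in> unit_disc" "w \<in> unit_disc"
  shows "norm (z - w) \<le> norm (1 - z * cnj w)"
proof -
  have "(norm (1 - z * cnj w))\<^sup>2 - (norm (z - w))\<^sup>2 = (1 - (norm z)\<^sup>2) * (1 - (norm w)\<^sup>2)"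
    unfolding cmod_power2 by (simp add: power2_eq_square algebra_simps)
  also have "\<dots> \<ge> 0"
    using power_le_one[of "norm z" 2] power_le_one[of "norm w" 2] assms
    by (intro mult_nonneg_nonneg) simp_all
  finally have "(norm (z - w))\<^sup>2 \<le> (norm (1 - z * cnj w))\<^sup>2"
    by simp
  then show ?thesis
    by (rule power2_le_imp_le) simp
qed

lemma norm_one_minus_mult_cnj_ge_depth:
  assumes "norm w \<le> 1"
  shows "1 - norm z \<le> norm (1 - z * cnj w)"
proof -
  have "norm (z * cnj w) \<le> norm z"
    using assms by (simp add: norm_mult mult_left_le)
  then show ?thesis
    using norm_triangle_ineq2[of 1 "z * cnj w"] by simp
qed

lemma norm_one_minus_mult_cnj_commute: "norm (1 - z * cnj w) = norm (1 - w * cnj z)"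
  by (metis complex_cnj_cnj complex_cnj_diff complex_cnj_mult complex_cnj_one complex_mod_cnj
      mult.commute)

lemma norm_K_integrand:
  "norm (K_integrand a f z w) = norm (f w) * norm (1 - z * cnj w) powr - a"
  by (simp add: K_integrand_def norm_divide norm_powr_complex powr_minus)
     (simp add: divide_inverse)

lemma measurable_kernel_base [measurable]:
  "(\<lambda>x. 1 - fst x * cnj (snd x)) \<in> borel_measurable (dA \<Otimes>\<^sub>M dA)"
proof -
  have c: "(\<lambda>w. cnj w) \<in> borel_measurable borel"
    by (intro borel_measurable_continuous_onI continuous_intros)
  note [measurable] = measurable_compose[OF _ c]
  show ?thesis by measurable
qed

text \<open>The complex power is discontinuous along the negative axis, so measurability uses that
  \<open>1 - z * cnj w\<close> stays in the right half-plane.\<close>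

lemma measurable_kernel:
  "(\<lambda>x. (1 - fst x * cnj (snd x)) powr of_real a) \<in> borel_measurable (dA \<Otimes>\<^sub>M dA)"
proof -
  let ?g = "\<lambda>u::complex. if u \<in> {u. 0 < Re u} then u powr of_real a else 0"
  have "?g \<in> borel_measurable borel"
    by (rule borel_measurable_continuous_on_if)
       (auto intro!: continuous_intros simp: complex_nonpos_Reals_iff)
  then have "(\<lambda>x. ?g (1 - fst x * cnj (snd x))) \<in> borel_measurable (dA \<Otimes>\<^sub>M dA)"
    by (rule measurable_compose[OF measurable_kernel_base])
  moreover have "0 < Re (1 - z * cnj w)" if "z \<in> unit_disc" "w \<in> unit_disc" for z w
  proof -
    have "norm (z * cnj w) < 1"
      using that mult_strict_mono[of "norm z" 1 "norm w" 1] by (simp add: norm_mult)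
    then show ?thesis
      using complex_Re_le_cmod[of "z * cnj w"] by simp
  qed
  ultimately show ?thesis
    by (subst measurable_cong) (auto simp: space_pair_measure space_dA)
qed

lemma measurable_K_integrand:
  assumes "f \<in> borel_measurable dA"
  shows "(\<lambda>(z, w). K_integrand a f z w) \<in> borel_measurable (dA \<Otimes>\<^sub>M dA)"
  unfolding K_integrand_def case_prod_unfold
  by (intro borel_measurable_divide measurable_kernel measurable_compose[OF measurable_snd assms])

lemma measurable_K_op:
  "f \<in> borel_measurable dA \<Longrightarrow> K_op a f \<in> borel_measurable dA"
  unfolding K_op_def by (intro dA.borel_measurable_lebesgue_integral measurable_K_integrand)

text \<open>The value \<open>2 powr a * (\<Sum>k. (2 powr (2 - a)) ^ k)\<close> of the geometric series that arises from
  the dyadic decomposition of the kernel below.\<close>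

definition kernel_const :: "real \<Rightarrow> real" where
  "kernel_const a = 2 powr a / (1 - 2 powr (2 - a))"

text \<open>The least \<open>k\<close> with \<open>D < 2 ^ k * d\<close> already gives a large enough term: by minimality
  \<open>2 ^ k * d / 2 \<le> D\<close>. In the application \<open>r\<close> is a distance and the indicators cut out balls, which
  turns an integral of \<open>D powr - a\<close> into a sum over areas of balls.\<close>

lemma powr_le_dyadic_sum:
  assumes "0 < d" "d \<le> D" "r \<le> D" "0 < a"
  shows "ennreal (D powr - a)
    \<le> (\<Sum>k. ennreal ((2 ^ k * d / 2) powr - a) * indicator {r<..} (2 ^ k * d))"
proof -
  define g where "g = (\<lambda>k. ennreal ((2 ^ k * d / 2) powr - a) * indicator {r<..} (2 ^ k * d))"
  obtain n where "D / d < 2 ^ n"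
    using real_arch_pow[of 2 "D / d"] by auto
  then have ex: "\<exists>n. D < 2 ^ n * d"
    using assms by (auto simp: field_simps)
  define k where "k = (LEAST n. D < 2 ^ n * d)"
  have k: "D < 2 ^ k * d"
    unfolding k_def using ex by (rule LeastI_ex)
  have k0: "k \<noteq> 0"
    using k assms by (cases k) auto
  then have "\<not> D < 2 ^ (k - 1) * d"
    unfolding k_def by (intro not_less_Least) simp
  then have "2 ^ k * d / 2 \<le> D"
    using k0 by (cases k) auto
  then have "D powr - a \<le> (2 ^ k * d / 2) powr - a"
    using assms by (intro powr_mono2') auto
  then have "ennreal (D powr - a) \<le> g k"
    using k assms by (auto simp: g_def indicator_def intro: ennreal_leI)
  also have "g k \<le> suminf g"
    using sum_le_suminf[of g "{k}"] by simp
  finally show ?thesis by (simp add: g_def)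
qed

lemma dyadic_shell_term_eq_geometric:
  fixes a d :: real
  assumes "0 < d"
  shows "(2 ^ k * d / 2) powr - a * (2 ^ k * d)\<^sup>2
    = 2 powr a * d powr (2 - a) * (2 powr (2 - a)) ^ k"
proof -
  have p: "(2 ^ k * d / 2) = 2 powr (real k - 1) * d" "(2 ^ k * d)\<^sup>2 = (2 powr real k * d) powr 2"
    using assms by (simp_all add: powr_diff powr_realpow)
  have "(2 ^ k * d / 2) powr - a * (2 ^ k * d)\<^sup>2
      = 2 powr ((real k - 1) * - a + real k * 2) * d powr (- a + 2)"
    using assms unfolding p powr_add by (simp add: powr_mult powr_powr)
  also have "(real k - 1) * - a + real k * 2 = a + (2 - a) * real k"
    by (simp add: algebra_simps)
  also have "2 powr (a + (2 - a) * real k) = 2 powr a * (2 powr (2 - a)) ^ k"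
    unfolding powr_add powr_powr[symmetric] by (subst powr_realpow) auto
  finally show ?thesis by (simp add: mult_ac)
qed

text \<open>The ball of radius \<open>2 ^ k * d\<close> has area at most \<open>(2 ^ k * d)\<^sup>2\<close>, and the dyadic bound
  gives it the weight \<open>(2 ^ k * d / 2) powr - a\<close>. The products form a geometric series with ratio
  \<open>2 powr (2 - a)\<close>, convergent because \<open>2 < a\<close>.\<close>

lemma nn_integral_kernel_le:
  assumes "2 < a" "0 < d" and z: "z \<in> unit_disc"
  shows "(\<integral>\<^sup>+w. indicator {w. d \<le> norm (1 - z * cnj w)} w
            * ennreal (norm (1 - z * cnj w) powr - a) \<partial>dA)
    \<le> ennreal (kernel_const a * d powr (2 - a))"
proof -
  let ?c = "\<lambda>k::nat. (2 ^ k * d / 2) powr - a"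
  let ?q = "(2::real) powr (2 - a)"
  have q: "0 < ?q" "?q < 1"
    using assms powr_less_mono[of "2 - a" 0 2] by auto
  have ballm: "ball z r \<inter> unit_disc \<in> sets dA" for r
    by (rule borel_Int_disc_in_sets_dA) auto
  have "(\<integral>\<^sup>+w. indicator {w. d \<le> norm (1 - z * cnj w)} w
            * ennreal (norm (1 - z * cnj w) powr - a) \<partial>dA)
      \<le> (\<integral>\<^sup>+w. (\<Sum>k. ennreal (?c k) * indicator (ball z (2 ^ k * d) \<inter> unit_disc) w) \<partial>dA)"
  proof (intro nn_integral_mono)
    fix w assume "w \<in> space dA"
    then have w: "w \<in> unit_disc" by (simp add: space_dA)
    show "indicator {w. d \<le> norm (1 - z * cnj w)} w * ennreal (norm (1 - z * cnj w) powr - a)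
      \<le> (\<Sum>k. ennreal (?c k) * indicator (ball z (2 ^ k * d) \<inter> unit_disc) w)"
    proof (cases "d \<le> norm (1 - z * cnj w)")
      case True
      have "ennreal (norm (1 - z * cnj w) powr - a)
          \<le> (\<Sum>k. ennreal (?c k) * indicator {norm (z - w)<..} (2 ^ k * d))"
        by (rule powr_le_dyadic_sum)
           (use assms True norm_one_minus_mult_cnj_ge_dist[OF z w] in auto)
      also have "\<dots> = (\<Sum>k. ennreal (?c k) * indicator (ball z (2 ^ k * d) \<inter> unit_disc) w)"
        using w by (intro suminf_cong) (auto simp: indicator_def dist_norm)
      finally show ?thesis using True by simp
    qed simp
  qed
  also have "\<dots> = (\<Sum>k. ennreal (?c k) * emeasure dA (ball z (2 ^ k * d) \<inter> unit_disc))"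
    using ballm by (simp add: nn_integral_suminf nn_integral_cmult)
  also have "\<dots> \<le> (\<Sum>k. ennreal (2 powr a * d powr (2 - a) * ?q ^ k))"
  proof (intro suminf_le)
    fix k :: nat
    have "ennreal (?c k) * emeasure dA (ball z (2 ^ k * d) \<inter> unit_disc)
        \<le> ennreal (?c k) * ennreal ((2 ^ k * d)\<^sup>2)"
      using assms by (intro mult_left_mono emeasure_dA_ball_le) auto
    also have "\<dots> = ennreal (?c k * (2 ^ k * d)\<^sup>2)"
      by (rule ennreal_mult[symmetric]) auto
    finally show "ennreal (?c k) * emeasure dA (ball z (2 ^ k * d) \<inter> unit_disc)
        \<le> ennreal (2 powr a * d powr (2 - a) * ?q ^ k)"
      unfolding dyadic_shell_term_eq_geometric[OF \<open>0 < d\<close>] .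
  qed auto
  also have "\<dots> = ennreal (\<Sum>k. 2 powr a * d powr (2 - a) * ?q ^ k)"
    using q by (intro suminf_ennreal2 summable_mult summable_geometric) auto
  also have "(\<Sum>k. 2 powr a * d powr (2 - a) * ?q ^ k) = kernel_const a * d powr (2 - a)"
  proof -
    have "(\<Sum>k. 2 powr a * d powr (2 - a) * ?q ^ k) = 2 powr a * d powr (2 - a) * (\<Sum>k. ?q ^ k)"
      using q by (intro suminf_mult summable_geometric) simp
    also have "(\<Sum>k. ?q ^ k) = 1 / (1 - ?q)"
      using q by (intro suminf_geometric) simp
    finally show ?thesis
      by (simp add: kernel_const_def)
  qed
  finally show ?thesis .
qed

lemma kernel_const_pos: "2 < a \<Longrightarrow> 0 < kernel_const a"
  using powr_less_mono[of "2 - a" 0 2] by (simp add: kernel_const_def)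

section \<open>The weak-type estimate\<close>

text \<open>The first summand takes care of the values \<open>x > T\<close>, the second of the others. Integrated, this
  plays the role of Hoelder's inequality with the parameter \<open>T\<close> left to be optimized.\<close>

lemma le_powr_truncate:
  fixes x :: real
  assumes "1 \<le> p" "0 < T" "0 \<le> x"
  shows "x \<le> T powr (1 - p) * x powr p + T"
proof (cases "x \<le> T")
  case False
  then have "1 \<le> (x / T) powr (p - 1)"
    using assms by (intro ge_one_powr_ge_zero) auto
  then have "x \<le> x * (x / T) powr (p - 1)"
    using assms by (simp add: mult_le_cancel_left1)
  also have "\<dots> = T powr (1 - p) * x powr p"
    using assms False by (simp add: powr_divide powr_diff field_simps)
  finally show ?thesis using assms by simp
qed (use assms in \<open>simp add: add_increasing\<close>)

lemma Lp_imp_integrable_dA: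
  assumes "1 \<le> p" "f \<in> Lp p"
  shows "integrable dA f"
proof (rule Bochner_Integration.integrable_bound)
  show "integrable dA (\<lambda>z. norm (f z) powr p + 1)"
    using assms by (auto simp: Lp_def)
  show "AE z in dA. norm (f z) \<le> norm (norm (f z) powr p + 1)"
    using le_powr_truncate[OF assms(1), of 1] by simp
qed (use assms in \<open>simp add: Lp_def\<close>)

text \<open>For fixed \<open>z\<close> inside the disc the kernel is a bounded function of \<open>w\<close>.\<close>

lemma integrable_K_integrand:
  assumes f: "integrable dA f" and a: "0 \<le> a" and z: "z \<in> unit_disc"
  shows "integrable dA (K_integrand a f z)"
proof (rule Bochner_Integration.integrable_bound)
  show "integrable dA (\<lambda>w. norm (f w) * (1 - norm z) powr - a)"
    using f by simp
  have "(\<lambda>w. (\<lambda>(z, w). K_integrand a f z w) (z, w)) \<in> borel_measurable dA"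
    using f z by (intro measurable_compose[OF measurable_Pair1' measurable_K_integrand])
       (auto simp: space_dA)
  then show "K_integrand a f z \<in> borel_measurable dA" by simp
  show "AE w in dA. norm (K_integrand a f z w) \<le> norm (norm (f w) * (1 - norm z) powr - a)"
  proof (rule AE_I2)
    fix w assume "w \<in> space dA"
    then have "1 - norm z \<le> norm (1 - z * cnj w)"
      by (intro norm_one_minus_mult_cnj_ge_depth) (simp add: space_dA)
    then have "norm (1 - z * cnj w) powr - a \<le> (1 - norm z) powr - a"
      using a z by (intro powr_mono2') auto
    then show "norm (K_integrand a f z w) \<le> norm (norm (f w) * (1 - norm z) powr - a)"
      by (simp add: norm_K_integrand mult_left_mono)
  qed
qed

text \<open>On \<open>E\<close> the truncation splits \<open>\<bar>f\<bar>\<close> into two parts. The part with \<open>\<bar>f\<bar> powr p\<close> is integrated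
  in \<open>z\<close> first, the constant part \<open>T\<close> in \<open>w\<close> first. In both cases the inner integral is that of the
  kernel over points with \<open>d \<le> \<bar>1 - z * cnj w\<bar>\<close>, since \<open>E\<close> stays at distance \<open>d\<close> from the
  unit circle.\<close>

lemma nn_integral_K_op_le:
  assumes "2 < a" "1 \<le> p" "0 < d" "0 < T" and f: "f \<in> borel_measurable dA"
    and E: "E \<in> sets dA" "E \<subseteq> cball 0 (1 - d)"
  shows "(\<integral>\<^sup>+z. indicator E z * ennreal (norm (K_op a f z)) \<partial>dA)
    \<le> ennreal (kernel_const a * d powr (2 - a))
        * (ennreal (T powr (1 - p)) * (\<integral>\<^sup>+w. ennreal (norm (f w) powr p) \<partial>dA)
            + ennreal T * emeasure dA E)"
proof -
  let ?k = "\<lambda>z w. ennreal (norm (1 - z * cnj w) powr - a)"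
  let ?C = "ennreal (kernel_const a * d powr (2 - a))"
  let ?F = "\<lambda>w. ennreal (T powr (1 - p)) * ennreal (norm (f w) powr p)"
  note f [measurable] E(1) [measurable]
  have disc: "E \<subseteq> unit_disc"
    using sets.sets_into_space[OF E(1)] by (simp add: space_dA)
  have depth: "d \<le> norm (1 - z * cnj w)" if "z \<in> E" "w \<in> unit_disc" for z w
    using that E norm_one_minus_mult_cnj_ge_depth[of w z] by force
  have km [measurable]: "(\<lambda>(z, w). ?k z w) \<in> borel_measurable (dA \<Otimes>\<^sub>M dA)"
    unfolding case_prod_unfold by measurable
  have km1 [measurable]: "(\<lambda>w. ?k z w) \<in> borel_measurable dA" if "z \<in> unit_disc" for z
    using measurable_compose[OF measurable_Pair1' km, of z] that by (simp add: space_dA)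
  have km2 [measurable]: "(\<lambda>z. ?k z w) \<in> borel_measurable dA" if "w \<in> unit_disc" for w
    using measurable_compose[OF measurable_Pair2' km, of w] that by (simp add: space_dA)
  have int_w: "(\<integral>\<^sup>+w. ?k z w \<partial>dA) \<le> ?C" if "z \<in> E" for z
  proof -
    have "(\<integral>\<^sup>+w. ?k z w \<partial>dA)
        = (\<integral>\<^sup>+w. indicator {w. d \<le> norm (1 - z * cnj w)} w * ?k z w \<partial>dA)"
      using depth[OF that] by (intro nn_integral_cong) (simp add: space_dA)
    also have "\<dots> \<le> ?C"
      using assms that disc by (intro nn_integral_kernel_le) auto
    finally show ?thesis .
  qed
  have int_z: "(\<integral>\<^sup>+z. indicator E z * ?k z w \<partial>dA) \<le> ?C" if "w \<in> unit_disc" for w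
  proof -
    have "(\<integral>\<^sup>+z. indicator E z * ?k z w \<partial>dA)
        \<le> (\<integral>\<^sup>+z. indicator {z. d \<le> norm (1 - w * cnj z)} z * ?k w z \<partial>dA)"
      using depth[OF _ that]
      by (intro nn_integral_mono)
         (auto simp: indicator_def norm_one_minus_mult_cnj_commute[of w])
    also have "\<dots> \<le> ?C"
      using assms that by (intro nn_integral_kernel_le) auto
    finally show ?thesis .
  qed
  have "(\<integral>\<^sup>+z. indicator E z * ennreal (norm (K_op a f z)) \<partial>dA)
      \<le> (\<integral>\<^sup>+z. indicator E z * (\<integral>\<^sup>+w. ?F w * ?k z w \<partial>dA)
            + indicator E z * (ennreal T * (\<integral>\<^sup>+w. ?k z w \<partial>dA)) \<partial>dA)"
  proof (intro nn_integral_mono)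
    fix z assume "z \<in> space dA"
    then have z: "z \<in> unit_disc" by (simp add: space_dA)
    have "ennreal (norm (K_op a f z)) \<le> (\<integral>\<^sup>+w. ennreal (norm (K_integrand a f z w)) \<partial>dA)"
      \<comment> \<open>Where the integrand is not integrable, the Bochner integral is 0 by convention.\<close>
    proof (cases "integrable dA (K_integrand a f z)")
      case True
      then show ?thesis
        unfolding K_op_def by (rule integral_norm_bound_ennreal)
    qed (simp add: K_op_def not_integrable_integral_eq)
    also have "\<dots> \<le> (\<integral>\<^sup>+w. ?F w * ?k z w + ennreal T * ?k z w \<partial>dA)"
    proof (intro nn_integral_mono)
      fix w
      have "norm (K_integrand a f z w)
          \<le> (T powr (1 - p) * norm (f w) powr p + T) * norm (1 - z * cnj w) powr - a"
        unfolding norm_K_integrand using le_powr_truncate[of p T "norm (f w)"] assms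
        by (intro mult_right_mono) auto
      then show "ennreal (norm (K_integrand a f z w)) \<le> ?F w * ?k z w + ennreal T * ?k z w"
        using assms by (simp add: distrib_right ennreal_leI flip: ennreal_mult ennreal_plus)
    qed
    also have "\<dots> = (\<integral>\<^sup>+w. ?F w * ?k z w \<partial>dA) + ennreal T * (\<integral>\<^sup>+w. ?k z w \<partial>dA)"
      using km1[OF z] by (simp add: nn_integral_add nn_integral_cmult)
    finally show "indicator E z * ennreal (norm (K_op a f z))
      \<le> indicator E z * (\<integral>\<^sup>+w. ?F w * ?k z w \<partial>dA)
            + indicator E z * (ennreal T * (\<integral>\<^sup>+w. ?k z w \<partial>dA))"
      by (simp add: mult_left_mono flip: distrib_left)
  qed
  also have "\<dots> = (\<integral>\<^sup>+z. indicator E z * (\<integral>\<^sup>+w. ?F w * ?k z w \<partial>dA) \<partial>dA)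
      + (\<integral>\<^sup>+z. indicator E z * (ennreal T * (\<integral>\<^sup>+w. ?k z w \<partial>dA)) \<partial>dA)"
    by (rule nn_integral_add) measurable
  also have "\<dots> \<le> ?C * (ennreal (T powr (1 - p)) * (\<integral>\<^sup>+w. ennreal (norm (f w) powr p) \<partial>dA))
      + ?C * (ennreal T * emeasure dA E)"
  proof (rule add_mono)
    have "(\<integral>\<^sup>+z. indicator E z * (\<integral>\<^sup>+w. ?F w * ?k z w \<partial>dA) \<partial>dA)
        = (\<integral>\<^sup>+z. (\<integral>\<^sup>+w. indicator E z * (?F w * ?k z w) \<partial>dA) \<partial>dA)"
      using km1 by (intro nn_integral_cong nn_integral_cmult[symmetric]) (auto simp: space_dA)
    also have "\<dots> = (\<integral>\<^sup>+w. (\<integral>\<^sup>+z. indicator E z * (?F w * ?k z w) \<partial>dA) \<partial>dA)"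
      by (rule dA2.Fubini'[symmetric]) measurable
    also have "\<dots> = (\<integral>\<^sup>+w. ?F w * (\<integral>\<^sup>+z. indicator E z * ?k z w \<partial>dA) \<partial>dA)"
    proof (intro nn_integral_cong)
      fix w assume "w \<in> space dA"
      then have [measurable]: "(\<lambda>z. ?k z w) \<in> borel_measurable dA"
        by (intro km2) (simp add: space_dA)
      show "(\<integral>\<^sup>+z. indicator E z * (?F w * ?k z w) \<partial>dA)
          = ?F w * (\<integral>\<^sup>+z. indicator E z * ?k z w \<partial>dA)"
        by (subst nn_integral_cmult[symmetric]) (auto simp: mult_ac)
    qed
    also have "\<dots> \<le> (\<integral>\<^sup>+w. ?F w * ?C \<partial>dA)"
      using int_z by (intro nn_integral_mono mult_left_mono) (auto simp: space_dA)
    also have "\<dots> = ?C * (ennreal (T powr (1 - p)) * (\<integral>\<^sup>+w. ennreal (norm (f w) powr p) \<partial>dA))"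
      by (simp add: nn_integral_multc nn_integral_cmult mult.commute)
    finally show "(\<integral>\<^sup>+z. indicator E z * (\<integral>\<^sup>+w. ?F w * ?k z w \<partial>dA) \<partial>dA) \<le> \<dots>" .
    have "(\<integral>\<^sup>+z. indicator E z * (ennreal T * (\<integral>\<^sup>+w. ?k z w \<partial>dA)) \<partial>dA)
        \<le> (\<integral>\<^sup>+z. (ennreal T * ?C) * indicator E z \<partial>dA)"
      using int_w by (intro nn_integral_mono) (auto simp: indicator_def intro: mult_left_mono)
    also have "\<dots> = (ennreal T * ?C) * emeasure dA E"
      using E(1) by (rule nn_integral_cmult_indicator)
    also have "\<dots> = ?C * (ennreal T * emeasure dA E)"
      by (simp add: mult_ac)
    finally show "(\<integral>\<^sup>+z. indicator E z * (ennreal T * (\<integral>\<^sup>+w. ?k z w \<partial>dA)) \<partial>dA) \<le> \<dots>" .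
  qed
  finally show ?thesis
    by (simp add: distrib_left)
qed

text \<open>The restriction to \<open>\<bar>z\<bar> \<le> 1 - e / 4\<close> costs at most half of the level set and makes the
  previous bound available with \<open>d\<close> comparable to its measure \<open>e\<close>. The number \<open>N\<close> is an upper bound
  for the norm rather than the norm itself, so that it is positive even if \<open>f\<close> vanishes almost
  everywhere.\<close>

lemma distribution_K_op_le:
  assumes a: "2 < a" "a < 3" and N: "0 < N" and l: "0 < l" and f: "f \<in> borel_measurable dA"
    and fN: "(\<integral>\<^sup>+w. ennreal (norm (f w) powr (1 / (3 - a))) \<partial>dA) \<le> ennreal (N powr (1 / (3 - a)))"
  shows "l * measure dA {z \<in> unit_disc. l < norm (K_op a f z)}
    \<le> 4 * 4 powr (a - 2) * kernel_const a * N"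
proof -
  define p where "p = 1 / (3 - a)"
  define E where "E = {z \<in> unit_disc. l < norm (K_op a f z)}"
  define e where "e = measure dA E"
  have p: "1 \<le> p" using a by (simp add: p_def)
  have [measurable]: "K_op a f \<in> borel_measurable dA"
    using f by (rule measurable_K_op)
  have "{z \<in> space dA. l < norm (K_op a f z)} \<in> sets dA" by measurable
  then have E: "E \<in> sets dA" by (simp add: E_def space_dA)
  have C: "0 < kernel_const a" using a by (intro kernel_const_pos)
  have "e \<le> measure dA (space dA)"
    unfolding e_def using E by (intro dA.finite_measure_mono sets.sets_into_space) auto
  then have e1: "e \<le> 1"
    by (simp add: space_dA measure_def emeasure_dA_unit_disc)
  show ?thesis
  proof (cases "e = 0")
    case True
    then show ?thesis
      using C N by (simp add: e_def E_def)
  next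
    case False
    then have e: "0 < e" by (simp add: e_def zero_less_measure_iff)
    define d where "d = e / 4"
    have d: "0 < d" "d \<le> 1" using e e1 by (auto simp: d_def)
    define E' where "E' = E \<inter> cball 0 (1 - d)"
    have E': "E' \<in> sets dA"
      using sets.Int[OF E borel_Int_disc_in_sets_dA[of "cball 0 (1 - d)"]]
        sets.sets_into_space[OF E]
      by (simp add: E'_def space_dA Int_absorb2 Int_assoc[symmetric] inf.absorb1 le_infI1)
    have ann: "unit_disc - cball 0 (1 - d) \<in> sets dA"
      using borel_Int_disc_in_sets_dA[of "- cball 0 (1 - d)"]
      by (simp add: Diff_eq Int_commute)
    have "e \<le> measure dA (E' \<union> (unit_disc - cball 0 (1 - d)))"
      unfolding e_def using E' ann
      by (intro dA.finite_measure_mono) (auto simp: E'_def E_def)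
    also have "\<dots> \<le> measure dA E' + measure dA (unit_disc - cball 0 (1 - d))"
      using E' ann by (rule measure_Un_le)
    also have "\<dots> \<le> measure dA E' + e / 2"
      using measure_dA_boundary_annulus_le[of d] d by (simp add: d_def)
    finally have half: "e / 2 \<le> measure dA E'" by simp
    have sub: "measure dA E' \<le> e"
      unfolding e_def using E by (intro dA.finite_measure_mono) (auto simp: E'_def)
    \<comment> \<open>\<open>a - 3 = - 1 / p\<close>; this height makes the two terms \<open>T powr (1 - p) * N powr p\<close> and
      \<open>T * e\<close> equal.\<close>
    define T where "T = N * e powr (a - 3)"
    have T: "0 < T" using N e by (simp add: T_def)
    let ?C = "kernel_const a * d powr (2 - a)"
    have Tp: "T powr (1 - p) * N powr p = N * e powr (a - 2)"
    proof -
      have "(a - 3) * (1 - p) = a - 2"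
        using a by (simp add: p_def field_simps)
      then have "T powr (1 - p) = N powr (1 - p) * e powr (a - 2)"
        using N e by (simp add: T_def powr_mult powr_powr)
      moreover have "N powr (1 - p) * N powr p = N"
        using N by (simp flip: powr_add)
      ultimately show ?thesis by (simp add: mult_ac)
    qed
    have Te: "T * e = N * e powr (a - 2)"
    proof -
      have "e powr (a - 2) = e powr (a - 3) * e"
        using e powr_add[of e "a - 3" 1] by simp
      then show ?thesis by (simp add: T_def)
    qed
    have "ennreal (l * measure dA E') = (\<integral>\<^sup>+z. ennreal l * indicator E' z \<partial>dA)"
      using E' l by (simp add: nn_integral_cmult_indicator dA.emeasure_eq_measure ennreal_mult)
    also have "\<dots> \<le> (\<integral>\<^sup>+z. indicator E' z * ennreal (norm (K_op a f z)) \<partial>dA)"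
      by (intro nn_integral_mono) (auto simp: indicator_def E'_def E_def intro!: ennreal_leI)
    also have "\<dots> \<le> ennreal ?C
        * (ennreal (T powr (1 - p)) * (\<integral>\<^sup>+w. ennreal (norm (f w) powr p) \<partial>dA)
            + ennreal T * emeasure dA E')"
      using a p d T f E' by (intro nn_integral_K_op_le) (auto simp: E'_def)
    also have "\<dots> \<le> ennreal ?C * (ennreal (T powr (1 - p)) * ennreal (N powr p) + ennreal T * ennreal e)"
      using fN sub unfolding p_def[symmetric]
      by (intro mult_left_mono add_mono) (auto simp: dA.emeasure_eq_measure ennreal_leI)
    also have "\<dots> = ennreal (?C * (T powr (1 - p) * N powr p + T * e))"
      using C T e by (simp flip: ennreal_mult ennreal_plus)
    finally have "l * measure dA E' \<le> ?C * (T powr (1 - p) * N powr p + T * e)"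
      using C T e by (subst (asm) ennreal_le_iff) auto
    also have "\<dots> = 2 * kernel_const a * N * (d powr (2 - a) * e powr (a - 2))"
      by (simp add: Tp Te)
    also have "d powr (2 - a) * e powr (a - 2) = 4 powr (a - 2)"
      using e by (simp add: d_def powr_divide powr_diff field_simps)
    finally have "l * measure dA E' \<le> 2 * kernel_const a * N * 4 powr (a - 2)" .
    moreover have "l * (e / 2) \<le> l * measure dA E'"
      using half l by (intro mult_left_mono) auto
    ultimately have "l * e \<le> 2 * (2 * kernel_const a * N * 4 powr (a - 2))"
      by linarith
    then show ?thesis
      by (simp add: e_def E_def mult_ac)
  qed
qed

lemma weak_L1_norm_K_op_le:
  assumes a: "2 < a" "a < 3" and f: "f \<in> Lp (1 / (3 - a))"
  shows "weak_L1_norm (K_op a f)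
    \<le> ennreal (4 * 4 powr (a - 2) * kernel_const a * Lp_norm (1 / (3 - a)) f)"
  unfolding weak_L1_norm_def
proof (rule SUP_least)
  fix l :: real assume "l \<in> {0<..}"
  then have l: "0 < l" by simp
  define p where "p = 1 / (3 - a)"
  define M where "M = Lp_norm p f"
  let ?A = "4 * 4 powr (a - 2) * kernel_const a"
  let ?E = "{z \<in> unit_disc. l < norm (K_op a f z)}"
  have A: "0 < ?A" using kernel_const_pos a by simp
  have p: "0 < p" using a by (simp add: p_def)
  have fm: "f \<in> borel_measurable dA" and int: "integrable dA (\<lambda>z. norm (f z) powr p)"
    using f by (auto simp: Lp_def p_def)
  have M: "0 \<le> M" by (simp add: M_def Lp_norm_def)
  have nn: "(\<integral>\<^sup>+w. ennreal (norm (f w) powr p) \<partial>dA) = ennreal (M powr p)"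
    using int p by (simp add: nn_integral_eq_integral M_def Lp_norm_def powr_powr)
  have "l * measure dA ?E \<le> ?A * M"
    \<comment> \<open>A positive bound for the norm is needed, so the norm is approached from above.\<close>
  proof (rule field_le_epsilon)
    fix \<epsilon> :: real assume \<epsilon>: "0 < \<epsilon>"
    have "l * measure dA ?E \<le> ?A * (M + \<epsilon> / ?A)"
    proof (rule distribution_K_op_le[OF a _ l fm])
      show pos: "0 < M + \<epsilon> / ?A" by (rule add_nonneg_pos[OF M divide_pos_pos[OF \<epsilon> A]])
      have "M powr p \<le> (M + \<epsilon> / ?A) powr p"
        using M p less_imp_le[OF divide_pos_pos[OF \<epsilon> A]] by (intro powr_mono2) auto
      then show "(\<integral>\<^sup>+w. ennreal (norm (f w) powr (1 / (3 - a))) \<partial>dA)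
          \<le> ennreal ((M + \<epsilon> / ?A) powr (1 / (3 - a)))"
        using nn by (simp add: p_def ennreal_leI)
    qed
    also have "\<dots> = ?A * M + \<epsilon>"
      using less_imp_neq[OF A] by (simp only: distrib_left) simp
    finally show "l * measure dA ?E \<le> ?A * M + \<epsilon>" .
  qed
  then show "ennreal l * emeasure dA ?E \<le> ennreal (?A * Lp_norm (1 / (3 - a)) f)"
    using l by (simp add: dA.emeasure_eq_measure M_def p_def ennreal_leI flip: ennreal_mult)
qed

theorem proposition4p3:
  fixes t :: real
  assumes "1 < t" and "t < 3 / 2"
  shows "(\<forall>f\<in>Lp (1 / (3 - 2 * t)). \<forall>z\<in>unit_disc. integrable dA (K_integrand (2 * t) f z)) \<and>
         bounded_Lp_to_weak_L1 (1 / (3 - 2 * t)) (K_op (2 * t))"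
proof -
  let ?p = "1 / (3 - 2 * t)"
  let ?A = "4 * 4 powr (2 * t - 2) * kernel_const (2 * t)"
  have t: "2 < 2 * t" "2 * t < 3" using assms by auto
  have p: "1 \<le> ?p" using assms by simp
  have int: "integrable dA (K_integrand (2 * t) f z)" if "f \<in> Lp ?p" "z \<in> unit_disc" for f z
    using assms that by (intro integrable_K_integrand Lp_imp_integrable_dA[OF p]) auto
  have bound: "weak_L1_norm (K_op (2 * t) f) \<le> ennreal (?A * Lp_norm ?p f)" if "f \<in> Lp ?p" for f
    using weak_L1_norm_K_op_le[OF t that] .
  have "K_op (2 * t) f \<in> weak_L1" if "f \<in> Lp ?p" for f
  proof -
    have "weak_L1_norm (K_op (2 * t) f) < \<infinity>"
      using bound[OF that] by (rule le_less_trans) simp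
    then show ?thesis
      using that measurable_K_op[of f] by (simp add: weak_L1_def Lp_def)
  qed
  moreover have "AE z in dA. K_op (2 * t) (\<lambda>w. a * f w + b * g w) z
      = a * K_op (2 * t) f z + b * K_op (2 * t) g z"
    if f: "f \<in> Lp ?p" and g: "g \<in> Lp ?p" for f g a b
  proof (rule AE_I2)
    fix z assume "z \<in> space dA"
    then have z: "z \<in> unit_disc" by (simp add: space_dA)
    have "K_integrand (2 * t) (\<lambda>w. a * f w + b * g w) z
        = (\<lambda>w. a * K_integrand (2 * t) f z w + b * K_integrand (2 * t) g z w)"
      by (simp add: K_integrand_def add_divide_distrib fun_eq_iff)
    then show "K_op (2 * t) (\<lambda>w. a * f w + b * g w) z
        = a * K_op (2 * t) f z + b * K_op (2 * t) g z"
      using int[OF f z] int[OF g z] by (simp add: K_op_def)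
  qed
  moreover have "\<exists>C\<ge>0. \<forall>f\<in>Lp ?p. weak_L1_norm (K_op (2 * t) f) \<le> ennreal (C * Lp_norm ?p f)"
    using bound kernel_const_pos[OF t(1)] by (intro exI[of _ ?A]) auto
  ultimately show ?thesis
    using int unfolding bounded_Lp_to_weak_L1_def by blast
qed

end
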